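(* Let $n\ge 2$, $\alpha\ge 1$, $M\ge 1$ be integers with $M\le n\alpha$, let $\mathbb{F}_q$ be a finite field (for instance $\mathbb{F}_2$), and let $G$ be the $M\times n\alpha$ ED-matrix over $\mathbb{F}_q$. Consider the storage scheme over the unidirectional ring network with parameters $(n,\alpha,M)$ in which, for $1\le i\le n$, the node generator matrix $G^{(i)}$ of $N_i$ consists of columns $(i-1)\alpha+1,\dots,i\alpha$ of $G$. Then this storage scheme is an optimal reconstructing distributed storage scheme (ORDSS); that is, every user can recover the original data with reconstructing bandwidth $kM-\frac{(k-1)k\alpha}{2}$, where $k=\lceil M/\alpha\rceil$.
   Context: Unidirectional ring network with parameters $(n,\alpha,M)$: there are $n$ storage nodes $N_1,\dots,N_n$ (indices modulo $n$) forming a directed ring; data can be sent only along the edges $N_j\to N_{j-1}$ (in particular $N_1\to N_n$). For each $i$ there is one user $U_i$, connected only to $N_i$ by an edge $N_i\to U_i$. The original data is a row vector $X\in\mathbb{F}_q^M$ of $M$ symbols over a finite field $\mathbb{F}_q$. Storage scheme (linear): a choice of a finite field $\mathbb{F}_q$ and of matrices $G^{(i)}\in\mathbb{F}_q^{M\times\alpha}$, $1\le i\le n$ (node generator matrices), such that the generator matrix $G=[G^{(1)},\dots,G^{(n)}]\in\mathbb{F}_q^{M\times n\alpha}$ has full row rank $M$. Node $N_i$ stores the $\alpha$ coordinates of $XG^{(i)}$; the $\alpha$ columns of $G^{(i)}$ are called the node vectors of $N_i$. Reconstruction protocol for user $U_i$: a finite sequence of transmissions, each sending one symbol of $\mathbb{F}_q$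 along an edge $N_j\to N_{j-1}$ of the ring or along $N_i\to U_i$. A symbol sent by $N_j$ is a fixed $\mathbb{F}_q$-linear combination of the symbols stored at $N_j$ and the symbols previously received by $N_j$; it thus corresponds to a transmitted vector in $\mathbb{F}_q^M$, the same linear combination of the corresponding vectors. User $U_i$ recovers (reconstructs) the original data if the vectors it receives span $\mathbb{F}_q^M$. The reconstructing bandwidth is the total number of symbols transmitted over all edges, including the edge $N_i\to U_i$. ORDSS: a storage scheme in which every user $U_i$, $1\le i\le n$, can recover the original data with reconstructing bandwidth exactly $kM-\frac{(k-1)k\alpha}{2}$, where $k=\lceil M/\alpha\rceil$ (this is the minimum possible reconstructing bandwidth). ED-matrix: for positive integers $M_0\le N$, the $M_0\times N$ ED-matrix is the 0/1 matrix $E(M_0,N)$ obtained from the Euclidean algorithm as follows. For nonnegative integers $a,b$, define the $a\times b$ matrix $E(a,b)$ recursively: it is empty if $a=0$ or $b=0$; if $1\le a\le b$, write $b=Pa+r$ with $0\le r<a$ and let $E(a,b)=[\,I_a\ \cdots\ I_a\ |\ E(a,r)\,]$ with $P$ copies of the identity $I_a$ placed side by side; if $a>b\ge 1$, write $a=Pb+r$ with $0\le r<b$ and let $E(a,b)$ be the vertical stack of $P$ copies of $I_b$ followed (below) by $E(r,b)$. *)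

theory Defs
  imports Complex_Main "Jordan_Normal_Form.DL_Rank"
begin

text \<open>Storage nodes and users are numbered \<open>1, \<dots>, n\<close>; rows and columns of matrices are
  numbered from \<open>0\<close>, as in the matrix library.\<close>

datatype vertex = Node nat | User nat

definition ring_pred :: "nat \<Rightarrow> nat \<Rightarrow> nat" where
  "ring_pred n j = (if j = 1 then n else j - 1)"

definition ring_edges :: "nat \<Rightarrow> (vertex \<times> vertex) set" where
  "ring_edges n = {(Node j, Node (ring_pred n j)) | j. j \<in> {1..n}}"

definition generator_mat :: "nat \<Rightarrow> nat \<Rightarrow> nat \<Rightarrow> (nat \<Rightarrow> 'a mat) \<Rightarrow> 'a mat" where
  "generator_mat n \<alpha> M Gs = mat M (n * \<alpha>) (\<lambda>(r, c). Gs (c div \<alpha> + 1) $$ (r, c mod \<alpha>))"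

definition storage_scheme ::
  "nat \<Rightarrow> nat \<Rightarrow> nat \<Rightarrow> (nat \<Rightarrow> 'a::{finite,field} mat) \<Rightarrow> bool" where
  "storage_scheme n \<alpha> M Gs \<longleftrightarrow>
     (\<forall>i\<in>{1..n}. Gs i \<in> carrier_mat M \<alpha>) \<and>
     vec_space.rank M (generator_mat n \<alpha> M Gs) = M"

fun stored_vectors :: "(nat \<Rightarrow> 'a mat) \<Rightarrow> vertex \<Rightarrow> 'a vec set" where
  "stored_vectors Gs (Node j) = set (cols (Gs j))"
| "stored_vectors Gs (User j) = {}"

definition vec_span :: "nat \<Rightarrow> 'a::field vec set \<Rightarrow> 'a vec set" where
  "vec_span M S = LinearCombinations.module.span class_ring (module_vec TYPE('a) M) S"

text \<open>A transmission is a triple of sender, receiver and transmitted vector. The transmitted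
  vector \<open>v\<close> stands for the symbol \<open>X \<bullet> v\<close>, where \<open>X\<close> is the original data.\<close>

type_synonym 'a transmission = "vertex \<times> vertex \<times> 'a vec"

definition received :: "'a transmission list \<Rightarrow> vertex \<Rightarrow> 'a vec set" where
  "received ts w = {v. \<exists>u. (u, w, v) \<in> set ts}"

definition is_protocol ::
  "nat \<Rightarrow> nat \<Rightarrow> (nat \<Rightarrow> 'a::{finite,field} mat) \<Rightarrow> nat \<Rightarrow> 'a transmission list \<Rightarrow> bool" where
  "is_protocol n M Gs i ts \<longleftrightarrow>
     (\<forall>t < length ts. case ts ! t of (u, w, v) \<Rightarrow>
        (u, w) \<in> insert (Node i, User i) (ring_edges n) \<and>
        v \<in> vec_span M (stored_vectors Gs u \<union> received (take t ts) u))"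

definition reconstructs :: "nat \<Rightarrow> nat \<Rightarrow> 'a::field transmission list \<Rightarrow> bool" where
  "reconstructs M i ts \<longleftrightarrow> vec_span M (received ts (User i)) = carrier_vec M"

definition bandwidth :: "'a transmission list \<Rightarrow> nat" where
  "bandwidth ts = length ts"

definition ordss ::
  "nat \<Rightarrow> nat \<Rightarrow> nat \<Rightarrow> (nat \<Rightarrow> 'a::{finite,field} mat) \<Rightarrow> bool" where
  "ordss n \<alpha> M Gs \<longleftrightarrow>
     storage_scheme n \<alpha> M Gs \<and>
     (\<forall>i\<in>{1..n}. \<exists>ts. is_protocol n M Gs i ts \<and> reconstructs M i ts \<and>
        (let k = real_of_int \<lceil>real M / real \<alpha>\<rceil>
         in real (bandwidth ts) = k * real M - (k - 1) * k * real \<alpha> / 2))"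

function ed_mat :: "nat \<Rightarrow> nat \<Rightarrow> 'a::{zero,one} mat" where
  "ed_mat a b =
     (if a = 0 \<or> b = 0 then 0\<^sub>m a b
      else if a \<le> b then
        mat a b (\<lambda>(r, c). if c < b div a * a then 1\<^sub>m a $$ (r, c mod a)
                          else ed_mat a (b mod a) $$ (r, c - b div a * a))
      else
        mat a b (\<lambda>(r, c). if r < a div b * b then 1\<^sub>m b $$ (r mod b, c)
                          else ed_mat (a mod b) b $$ (r - a div b * b, c)))"
  by pat_completeness auto
termination
  by (relation "Wellfounded.measure (\<lambda>(a, b). a + b)")
    (auto simp: not_le intro: order.strict_trans2[OF mod_less_divisor])

declare ed_mat.simps [simp del]

definition node_block :: "nat \<Rightarrow> 'a mat \<Rightarrow> nat \<Rightarrow> 'a mat" where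
  "node_block \<alpha> G i = mat (dim_row G) \<alpha> (\<lambda>(r, c). G $$ (r, (i - 1) * \<alpha> + c))"

end

theory Submission
  imports Defs
begin

text \<open>Any \<open>M\<close> cyclically consecutive columns of the ED-matrix span the whole space.  Granted this,
  user \<open>i\<close> receives the \<open>M\<close> columns \<open>g 0, \<dots>, g (M - 1)\<close> that start at node \<open>i\<close>: the node at
  distance \<open>t\<close> upstream forwards \<open>g j\<close> for all \<open>j \<ge> t * \<alpha>\<close>, the first \<open>\<alpha>\<close> of which it stores while
  the others have just reached it, so that the bandwidth is the sum of \<open>M - t * \<alpha>\<close> over \<open>t < k\<close>.

  For the spanning property, cancelling unit columns or unit rows against each other reduces a window
  that does not wrap around to a leading square block, which is an identity matrix, and a window
  that wraps around to a trailing square block. A trailing block reduces in the same way either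
  to a trailing block of a smaller ED-matrix, along the Euclidean algorithm, or to a window of
  rows or columns that does not wrap around.\<close>

subsection \<open>Spans of column vectors\<close>

lemma vec_span_mono: "S \<subseteq> T \<Longrightarrow> vec_span M S \<subseteq> vec_span M T"
proof -
  interpret vec_space "TYPE('a::field)" M .
  show "S \<subseteq> T \<Longrightarrow> vec_span M S \<subseteq> vec_span M (T :: 'a vec set)"
    unfolding vec_span_def by (rule span_is_monotone)
qed

lemma vec_span_mem:
  fixes v :: "'a::field vec"
  assumes "v \<in> S" "v \<in> carrier_vec M"
  shows "v \<in> vec_span M S"
proof -
  interpret vec_space "TYPE('a)" M .
  have "v \<in> vec_span M {v}"
    unfolding vec_span_def using assms(2) by (intro span_mem) auto
  then show ?thesis using vec_span_mono[of "{v}" S M] assms(1) by auto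
qed

lemma vec_span_closed:
  fixes S :: "'a::field vec set"
  assumes "S \<subseteq> carrier_vec M"
  shows "vec_span M S \<subseteq> carrier_vec M"
proof -
  interpret vec_space "TYPE('a)" M .
  show ?thesis unfolding vec_span_def using span_is_subset2[of S] assms by auto
qed

lemma rank_eq_if_cols_span:
  fixes A :: "'a::field mat"
  assumes "vec_span M (set (cols A)) = carrier_vec M"
  shows "vec_space.rank M A = M"
proof -
  interpret vec_space "TYPE('a)" M .
  have "span_vs (set (cols A)) = V"
    using assms unfolding vec_span_def by (simp add: module_vec_def)
  then show ?thesis unfolding rank_def using dim_is_n by simp
qed

subsection \<open>Relay protocols\<close>

lemma is_protocol_Nil: "is_protocol n M Gs i []"
  by (simp add: is_protocol_def)

lemma received_mono: "set ts \<subseteq> set us \<Longrightarrow> received ts w \<subseteq> received us w"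
  by (auto simp: received_def)

text \<open>Every appended transmission is justified by what its sender holds after
  \<open>ts\<close> alone. A longer prefix only enlarges the span, so the order inside
  \<open>bs\<close> does not matter.\<close>

lemma is_protocol_append:
  assumes ts: "is_protocol n M Gs i ts"
    and bs: "\<And>u w v. (u, w, v) \<in> set bs \<Longrightarrow>
      (u, w) \<in> insert (Node i, User i) (ring_edges n) \<and>
      v \<in> vec_span M (stored_vectors Gs u \<union> received ts u)"
  shows "is_protocol n M Gs i (ts @ bs)"
  unfolding is_protocol_def
proof (intro allI impI)
  fix t assume t: "t < length (ts @ bs)"
  obtain u w v where uwv: "(ts @ bs) ! t = (u, w, v)" by (cases "(ts @ bs) ! t") auto
  have "(u, w) \<in> insert (Node i, User i) (ring_edges n) \<and>
    v \<in> vec_span M (stored_vectors Gs u \<union> received (take t (ts @ bs)) u)"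
  proof (cases "t < length ts")
    case True
    then show ?thesis
      using ts uwv unfolding is_protocol_def by (fastforce simp: nth_append)
  next
    case False
    then have "(u, w, v) \<in> set bs"
      using uwv t by (auto simp: nth_append in_set_conv_nth intro!: exI[of _ "t - length ts"])
    moreover have "received ts u \<subseteq> received (take t (ts @ bs)) u"
      using False by (intro received_mono) auto
    ultimately show ?thesis
      using bs[of u w v] vec_span_mono[of "stored_vectors Gs u \<union> received ts u"
          "stored_vectors Gs u \<union> received (take t (ts @ bs)) u" M] by blast
  qed
  then show "case (ts @ bs) ! t of (u, w, v) \<Rightarrow>
      (u, w) \<in> insert (Node i, User i) (ring_edges n) \<and>
      v \<in> vec_span M (stored_vectors Gs u \<union> received (take t (ts @ bs)) u)"
    using uwv by simp
qed

text \<open>Nodes are numbered from 1, so the index is lowered before the reduction modulo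
  \<open>n\<close> and raised again afterwards. Distance 0 is node \<open>i\<close> itself.\<close>

definition upstream :: "nat \<Rightarrow> nat \<Rightarrow> nat \<Rightarrow> nat" where
  "upstream n i t = (i - 1 + t) mod n + 1"

definition next_hop :: "nat \<Rightarrow> nat \<Rightarrow> nat \<Rightarrow> vertex" where
  "next_hop n i t = (case t of 0 \<Rightarrow> User i | Suc t' \<Rightarrow> Node (upstream n i t'))"

lemma next_hop_edge:
  assumes "i \<in> {1..n}"
  shows "(Node (upstream n i t), next_hop n i t) \<in> insert (Node i, User i) (ring_edges n)"
proof (cases t)
  case 0
  then show ?thesis using assms by (auto simp: upstream_def next_hop_def)
next
  case (Suc t')
  have "ring_pred n (upstream n i (Suc t')) = upstream n i t'"
    by (simp add: ring_pred_def upstream_def mod_Suc)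
  moreover have "upstream n i (Suc t') \<in> {1..n}"
    using assms by (auto simp: upstream_def Suc_le_eq)
  ultimately show ?thesis using Suc by (auto simp: ring_edges_def next_hop_def)
qed

definition relay_round ::
  "nat \<Rightarrow> nat \<Rightarrow> nat \<Rightarrow> (nat \<Rightarrow> 'a vec) \<Rightarrow> nat \<Rightarrow> nat \<Rightarrow> 'a transmission list" where
  "relay_round n \<alpha> M g i t =
     map (\<lambda>j. (Node (upstream n i t), next_hop n i t, g j)) [t * \<alpha>..<M]"

text \<open>Rounds run from the farthest node, at distance \<open>k - 1\<close>, towards the user.
  The count \<open>d\<close> of completed rounds is separate from \<open>k\<close> to allow
  induction on it.\<close>

definition relay_rounds ::
  "nat \<Rightarrow> nat \<Rightarrow> nat \<Rightarrow> (nat \<Rightarrow> 'a vec) \<Rightarrow> nat \<Rightarrow> nat \<Rightarrow> nat \<Rightarrow> 'a transmission list" where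
  "relay_rounds n \<alpha> M g i k d =
     concat (map (\<lambda>e. relay_round n \<alpha> M g i (k - Suc e)) [0..<d])"

lemma relay_rounds_Suc:
  "relay_rounds n \<alpha> M g i k (Suc d) =
     relay_rounds n \<alpha> M g i k d @ relay_round n \<alpha> M g i (k - Suc d)"
  by (simp add: relay_rounds_def)

lemma relay_rounds_protocol:
  fixes g :: "nat \<Rightarrow> 'a::{finite,field} vec"
  assumes "i \<in> {1..n}" "M \<le> k * \<alpha>" "d \<le> k"
    and g: "\<And>j. j < M \<Longrightarrow> g j \<in> carrier_vec M"
    and stored: "\<And>t j. t * \<alpha> \<le> j \<Longrightarrow> j < t * \<alpha> + \<alpha> \<Longrightarrow>
      g j \<in> stored_vectors Gs (Node (upstream n i t))"
  shows "is_protocol n M Gs i (relay_rounds n \<alpha> M g i k d)"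
  using \<open>d \<le> k\<close>
proof (induction d)
  case 0
  then show ?case by (simp add: relay_rounds_def is_protocol_Nil)
next
  case (Suc d)
  define t where "t = k - Suc d"
  let ?ts = "relay_rounds n \<alpha> M g i k d"
  have "g j \<in> stored_vectors Gs (Node (upstream n i t)) \<union> received ?ts (Node (upstream n i t))"
    if j: "t * \<alpha> \<le> j" "j < M" for j
  proof (cases "j < t * \<alpha> + \<alpha>")
    case True
    then show ?thesis using stored j by blast
  next
    case False
    \<comment> \<open>The farthest node has no earlier round to draw on, but
      \<open>M \<le> k * \<alpha>\<close> leaves it no vectors beyond its own stored block.\<close>
    have "d \<noteq> 0"
    proof
      assume "d = 0"
      then have "k = Suc t" using Suc.prems by (simp add: t_def)
      then show False using assms(2) False j by simp
    qed
    then obtain d' where d': "d = Suc d'" by (cases d) auto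
    have "k - Suc d' = Suc t" using Suc.prems d' by (simp add: t_def)
    then have "(Node (upstream n i (Suc t)), Node (upstream n i t), g j) \<in> set ?ts"
      using False j by (auto simp: d' relay_rounds_Suc relay_round_def next_hop_def)
    then show ?thesis by (auto simp: received_def)
  qed
  then have "g j \<in> vec_span M (stored_vectors Gs (Node (upstream n i t)) \<union>
      received ?ts (Node (upstream n i t)))" if "t * \<alpha> \<le> j" "j < M" for j
    using that g by (intro vec_span_mem) auto
  then show ?case
    unfolding relay_rounds_Suc t_def[symmetric]
    using Suc next_hop_edge[OF assms(1), of t]
    by (intro is_protocol_append) (auto simp: relay_round_def)
qed

lemma received_relay_rounds:
  assumes "0 < k"
  shows "g ` {0..<M} \<subseteq> received (relay_rounds n \<alpha> M g i k k) (User i)"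
proof -
  obtain k' where "k = Suc k'" using assms by (cases k) auto
  then show ?thesis
    by (auto simp: relay_rounds_Suc received_def relay_round_def next_hop_def image_iff)
qed

lemma received_relay_rounds_subset:
  "received (relay_rounds n \<alpha> M g i k d) w \<subseteq> g ` {0..<M}"
  by (auto simp: received_def relay_rounds_def relay_round_def)

section \<open>Counting the transmitted symbols\<close>

lemma length_relay_rounds:
  "length (relay_rounds n \<alpha> M g i k k) = (\<Sum>t<k. M - t * \<alpha>)"
proof -
  have "length (relay_rounds n \<alpha> M g i k d) = (\<Sum>e<d. M - (k - Suc e) * \<alpha>)" for d
    by (induction d) (simp_all add: relay_rounds_def relay_round_def)
  then show ?thesis by (simp add: sum.nat_diff_reindex[of "\<lambda>t. M - t * \<alpha>"])
qed

text \<open>The hypothesis makes every natural-number subtraction exact, so the loads form an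
  arithmetic progression.\<close>

lemma sum_relay_loads:
  assumes "\<And>t. t < k \<Longrightarrow> t * \<alpha> \<le> M"
  shows "real (\<Sum>t<k. M - t * \<alpha>) =
    real k * real M - (real k - 1) * real k * real \<alpha> / 2"
  using assms
proof (induction k)
  case (Suc k)
  have "real (\<Sum>t<Suc k. M - t * \<alpha>) = real (\<Sum>t<k. M - t * \<alpha>) + (real M - real k * real \<alpha>)"
    using Suc.prems[of k] by simp
  also have "\<dots> = real (Suc k) * real M - (real (Suc k) - 1) * real (Suc k) * real \<alpha> / 2"
    using Suc by (simp add: field_simps del: of_nat_sum)
  finally show ?case .
qed simp

text \<open>Supplies both bounds on \<open>k\<close>: the blocks of \<open>k\<close> nodes cover all
  \<open>M\<close> vectors, and no load \<open>M - t * \<alpha>\<close> with \<open>t < k\<close> is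
  truncated.\<close>

lemma ceiling_divide_nat:
  fixes M \<alpha> :: nat
  assumes "0 < M" "0 < \<alpha>"
  obtains k where "real_of_int \<lceil>real M / real \<alpha>\<rceil> = real k" "0 < k" "M \<le> k * \<alpha>"
    "\<And>t. t < k \<Longrightarrow> t * \<alpha> \<le> M"
proof -
  define k where "k = nat \<lceil>real M / real \<alpha>\<rceil>"
  have pos: "0 < real M / real \<alpha>" using assms by simp
  then have k: "real_of_int \<lceil>real M / real \<alpha>\<rceil> = real k" "0 < k"
    by (simp_all add: k_def)
  have "real M / real \<alpha> \<le> real k" using k(1) by linarith
  then have "M \<le> k * \<alpha>"
    using assms by (simp add: pos_divide_le_eq flip: of_nat_mult)
  moreover have "t * \<alpha> \<le> M" if "t < k" for t
  proof -
    have "real t \<le> real M / real \<alpha>" using k(1) that by linarith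
    then show ?thesis using assms by (simp add: pos_le_divide_eq flip: of_nat_mult)
  qed
  ultimately show ?thesis using that k by blast
qed

section \<open>Columns of the generator matrix as node vectors\<close>

lemma node_block_column_stored:
  fixes G :: "'a mat"
  assumes "dim_col G = n * \<alpha>" "0 < n" "t * \<alpha> \<le> j" "j < t * \<alpha> + \<alpha>"
  shows "col G (((i - 1) * \<alpha> + j) mod (n * \<alpha>))
    \<in> stored_vectors (node_block \<alpha> G) (Node (upstream n i t))"
proof -
  define c where "c = j - t * \<alpha>"
  define x where "x = (i - 1 + t) mod n"
  have c: "c < \<alpha>" "j = t * \<alpha> + c" using assms by (auto simp: c_def)
  have "x < n" using assms by (simp add: x_def)
  have "x * \<alpha> + c < n * \<alpha>"
  proof -
    have "x * \<alpha> + c < Suc x * \<alpha>" using c by simp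
    also have "\<dots> \<le> n * \<alpha>" using \<open>x < n\<close> by (intro mult_le_mono1) simp
    finally show ?thesis .
  qed
  have "((i - 1) * \<alpha> + j) mod (\<alpha> * n) = ((i - 1 + t) * \<alpha> + c) mod (\<alpha> * n)"
    by (simp add: c algebra_simps)
  \<comment> \<open>Reduction modulo \<open>\<alpha> * n\<close> reduces the block number modulo
    \<open>n\<close> and keeps the offset \<open>c < \<alpha>\<close> inside the block.\<close>
  also have "\<dots> = x * \<alpha> + c"
    unfolding mod_mult2_eq using c by (simp add: x_def)
  finally have "((i - 1) * \<alpha> + j) mod (n * \<alpha>) = x * \<alpha> + c" by (simp add: mult.commute)
  moreover have "col G (x * \<alpha> + c) = col (node_block \<alpha> G (Suc x)) c"
    using c assms(1) \<open>x * \<alpha> + c < n * \<alpha>\<close> by (intro eq_vecI) (auto simp: node_block_def)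
  moreover have "col (node_block \<alpha> G (Suc x)) c \<in> set (cols (node_block \<alpha> G (Suc x)))"
    using c by (auto simp: cols_def node_block_def)
  ultimately show ?thesis by (simp add: upstream_def x_def)
qed

lemma generator_mat_node_block:
  assumes "G \<in> carrier_mat M (n * \<alpha>)"
  shows "generator_mat n \<alpha> M (node_block \<alpha> G) = G"
proof (rule eq_matI)
  fix r c assume "r < dim_row G" "c < dim_col G"
  moreover from this have "0 < \<alpha>" using assms by (cases "\<alpha> = 0") auto
  ultimately show "generator_mat n \<alpha> M (node_block \<alpha> G) $$ (r, c) = G $$ (r, c)"
    using assms by (auto simp: generator_mat_def node_block_def)
qed (use assms in \<open>auto simp: generator_mat_def\<close>)

subsection \<open>Trivial left kernels\<close>

text \<open>The rows in \<open>R\<close>, restricted to the columns in \<open>C\<close>, are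
  linearly independent; for a square window this is nonsingularity. Index sets replace submatrices
  so that rows and columns can be removed without renumbering.\<close>

definition trivial_left_kernel ::
  "(nat \<Rightarrow> nat \<Rightarrow> 'a::field) \<Rightarrow> nat set \<Rightarrow> nat set \<Rightarrow> bool" where
  "trivial_left_kernel f R C \<longleftrightarrow>
     (\<forall>x. (\<forall>c\<in>C. (\<Sum>r\<in>R. x r * f r c) = 0) \<longrightarrow> (\<forall>r\<in>R. x r = 0))"

lemma trivial_left_kernelI:
  assumes "\<And>x r. (\<And>c. c \<in> C \<Longrightarrow> (\<Sum>r\<in>R. x r * f r c) = 0) \<Longrightarrow> r \<in> R \<Longrightarrow> x r = 0"
  shows "trivial_left_kernel f R C"
  using assms unfolding trivial_left_kernel_def by blast

lemma trivial_left_kernelD: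
  assumes "trivial_left_kernel f R C" "\<And>c. c \<in> C \<Longrightarrow> (\<Sum>r\<in>R. x r * f r c) = 0" "r \<in> R"
  shows "x r = 0"
  using assms unfolding trivial_left_kernel_def by blast

lemma trivial_left_kernel_empty: "trivial_left_kernel f {} C"
  by (rule trivial_left_kernelI) simp

lemma trivial_left_kernel_cong:
  assumes "trivial_left_kernel g R C" "\<And>r c. r \<in> R \<Longrightarrow> c \<in> C \<Longrightarrow> f r c = g r c"
  shows "trivial_left_kernel f R C"
proof (rule trivial_left_kernelI)
  fix x r assume x: "\<And>c. c \<in> C \<Longrightarrow> (\<Sum>r\<in>R. x r * f r c) = 0" and "r \<in> R"
  have "(\<Sum>r\<in>R. x r * g r c) = 0" if "c \<in> C" for c
    using x[OF that] assms(2)[OF _ that] by simp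
  then show "x r = 0"
    using trivial_left_kernelD[OF assms(1)] \<open>r \<in> R\<close> by blast
qed

text \<open>Moves a window of a smaller ED-matrix to the place which that matrix occupies inside a
  larger one.\<close>

lemma trivial_left_kernel_shift:
  assumes "trivial_left_kernel (\<lambda>r c. f (r + p) (c + q)) {a..<b} {c..<d}"
  shows "trivial_left_kernel f {a + p..<b + p} {c + q..<d + q}"
proof (rule trivial_left_kernelI)
  fix x r
  assume x: "\<And>j. j \<in> {c + q..<d + q} \<Longrightarrow> (\<Sum>r\<in>{a + p..<b + p}. x r * f r j) = 0"
    and r: "r \<in> {a + p..<b + p}"
  have "(\<Sum>r\<in>{a..<b}. x (r + p) * f (r + p) (j + q)) = 0" if "j \<in> {c..<d}" for j
    using x[of "j + q"] that sum.shift_bounds_nat_ivl[of "\<lambda>r. x r * f r (j + q)" a p b] by simp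
  from trivial_left_kernelD[OF assms, of "\<lambda>r. x (r + p)" "r - p", OF this] r
  show "x r = 0" by (auto simp: le_diff_conv2 less_diff_conv2)
qed

text \<open>The equation of a column that is a unit vector on \<open>R\<close> reads
  \<open>x (p c) = 0\<close>. These rows drop out of all other equations, and the rows in
  \<open>R2\<close> are settled by the columns in \<open>C2\<close>.\<close>

lemma trivial_left_kernel_unit_columns:
  assumes "finite R"
    and unit: "\<And>r c. c \<in> C1 \<Longrightarrow> r \<in> R \<Longrightarrow> f r c = (if r = p c then 1 else 0)"
    and "R - p ` C1 \<subseteq> R2" "R2 \<subseteq> R"
    and rest: "trivial_left_kernel f R2 C2"
    and "C1 \<union> C2 \<subseteq> C"
  shows "trivial_left_kernel f R C"
proof (rule trivial_left_kernelI)
  fix x r assume x: "\<And>c. c \<in> C \<Longrightarrow> (\<Sum>r\<in>R. x r * f r c) = 0" and r: "r \<in> R"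
  have z: "x s = 0" if s: "s \<in> R" "s \<in> p ` C1" for s
  proof -
    obtain c where c: "c \<in> C1" "s = p c" using s by blast
    have "(\<Sum>r\<in>R. x r * f r c) = (\<Sum>r\<in>R. if r = s then x r else 0)"
      using unit[OF c(1)] c(2) by (intro sum.cong) auto
    also have "\<dots> = x s" using \<open>finite R\<close> s by simp
    finally show ?thesis using x[of c] c assms(6) by auto
  qed
  have "(\<Sum>r\<in>R2. x r * f r c) = 0" if "c \<in> C2" for c
  proof -
    have "(\<Sum>r\<in>R2. x r * f r c) = (\<Sum>r\<in>R. x r * f r c)"
      by (rule sum.mono_neutral_left) (use assms z in auto)
    then show ?thesis using x[of c] that assms(6) by auto
  qed
  then have "x s = 0" if "s \<in> R2" for s
    using trivial_left_kernelD[OF rest, of x] that by blast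
  then show "x r = 0" using z r assms(3) by blast
qed

lemma trivial_left_kernel_unit_rows:
  assumes "finite R"
    and "R = R1 \<union> R2" "R1 \<inter> R2 = {}"
    and unit: "\<And>r c. r \<in> R1 \<Longrightarrow> c \<in> C \<Longrightarrow> f r c = (if c = p r then 1 else 0)"
    and "inj_on p R1" "p ` R1 \<subseteq> C"
    and rest: "trivial_left_kernel f R2 C2"
    and C2: "C2 \<subseteq> C - p ` R1"
  shows "trivial_left_kernel f R C"
proof (rule trivial_left_kernelI)
  fix x r assume x: "\<And>c. c \<in> C \<Longrightarrow> (\<Sum>r\<in>R. x r * f r c) = 0" and r: "r \<in> R"
  have split: "(\<Sum>r\<in>R. x r * f r c) = (\<Sum>r\<in>R1. x r * f r c) + (\<Sum>r\<in>R2. x r * f r c)" for c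
    using assms(1-3) by (simp add: sum.union_disjoint)
  have "(\<Sum>r\<in>R2. x r * f r c) = 0" if c: "c \<in> C2" for c
  proof -
    have "(\<Sum>r\<in>R1. x r * f r c) = 0"
      using c C2 by (intro sum.neutral) (auto simp: unit image_iff)
    then show ?thesis using x[of c] split[of c] c C2 by auto
  qed
  then have z: "x s = 0" if "s \<in> R2" for s
    using trivial_left_kernelD[OF rest, of x] that by blast
  have "x r = 0" if r: "r \<in> R1"
  proof -
    have "p r \<in> C" using r assms(6) by blast
    then have "(\<Sum>s\<in>R1. x s * f s (p r)) = (\<Sum>s\<in>R1. if s = r then x s else 0)"
      using unit[of _ "p r"] r assms(5) by (intro sum.cong) (auto dest: inj_onD)
    also have "\<dots> = x r" using assms(1,2) r by simp
    finally show ?thesis using x[OF \<open>p r \<in> C\<close>] split[of "p r"] z by simp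
  qed
  then show "x r = 0" using z r assms(2) by blast
qed

subsection \<open>Windows of ED-matrices\<close>

lemma ed_mat_carrier: "ed_mat a b \<in> carrier_mat a b"
  by (subst ed_mat.simps) auto

lemma ed_mat_dims [simp]: "dim_row (ed_mat a b) = a" "dim_col (ed_mat a b) = b"
  using ed_mat_carrier[of a b] by auto

lemma ed_mat_wide_index:
  assumes "a \<le> b" "r < a" "c < b"
  shows "ed_mat a b $$ (r, c) =
    (if c < b div a * a then if r = c mod a then 1 else 0
     else ed_mat a (b mod a) $$ (r, c - b div a * a))"
  using assms by (subst ed_mat.simps) auto

lemma ed_mat_tall_index:
  assumes "b < a" "r < a" "c < b"
  shows "ed_mat a b $$ (r, c) =
    (if r < a div b * b then if c = r mod b then 1 else 0
     else ed_mat (a mod b) b $$ (r - a div b * b, c))"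
  using assms by (subst ed_mat.simps) auto

text \<open>One Euclidean step in additive form: \<open>q\<close> is the total width of the identity
  blocks, not the quotient, and \<open>r\<close> is the width of the remaining ED-matrix.\<close>

lemma ed_mat_wide_cases:
  assumes "0 < a" "a \<le> b"
  obtains q r where "b = q + r" "r < a" "a \<le> q" "a dvd q"
    "\<And>i c. i < a \<Longrightarrow> c < q \<Longrightarrow> ed_mat a b $$ (i, c) = (if i = c mod a then 1 else 0)"
    "\<And>i c. i < a \<Longrightarrow> c < r \<Longrightarrow> ed_mat a b $$ (i, c + q) = ed_mat a r $$ (i, c)"
proof (rule that[of "b div a * a" "b mod a"])
  show "a \<le> b div a * a"
    using assms by (simp add: Suc_le_eq div_greater_zero_iff)
  have "b div a * a \<le> b" by simp
  then show "ed_mat a b $$ (i, c) = (if i = c mod a then 1 else 0)"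
    if "i < a" "c < b div a * a" for i c
    using ed_mat_wide_index[of a b i c] that assms by (simp del: div_times_less_eq_dividend)
  show "ed_mat a b $$ (i, c + b div a * a) = ed_mat a (b mod a) $$ (i, c)"
    if "i < a" "c < b mod a" for i c
    using ed_mat_wide_index[of a b i "c + b div a * a"] that assms div_mult_mod_eq[of b a] by auto
qed (use assms in auto)

lemma ed_mat_tall_cases:
  assumes "0 < b" "b < a"
  obtains q r where "a = q + r" "r < b" "b \<le> q" "b dvd q"
    "\<And>i c. i < q \<Longrightarrow> c < b \<Longrightarrow> ed_mat a b $$ (i, c) = (if c = i mod b then 1 else 0)"
    "\<And>i c. i < r \<Longrightarrow> c < b \<Longrightarrow> ed_mat a b $$ (i + q, c) = ed_mat r b $$ (i, c)"
proof (rule that[of "a div b * b" "a mod b"])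
  show "b \<le> a div b * b"
    using assms by (simp add: Suc_le_eq div_greater_zero_iff)
  have "a div b * b \<le> a" by simp
  then show "ed_mat a b $$ (i, c) = (if c = i mod b then 1 else 0)"
    if "i < a div b * b" "c < b" for i c
    using ed_mat_tall_index[of b a i c] that assms by (simp del: div_times_less_eq_dividend)
  show "ed_mat a b $$ (i + a div b * b, c) = ed_mat (a mod b) b $$ (i, c)"
    if "i < a mod b" "c < b" for i c
    using ed_mat_tall_index[of b a "i + a div b * b" c] that assms div_mult_mod_eq[of a b] by auto
qed (use assms in auto)

text \<open>Whichever side is shorter, the recursion starts with a complete identity block of that
  size.\<close>

lemma ed_mat_leading:
  assumes "r < a" "c < b" "r < b" "c < a"
  shows "ed_mat a b $$ (r, c) = (if r = c then 1 else 0 :: 'a::{zero,one})"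
proof (cases "a \<le> b")
  case True
  show ?thesis
    by (rule ed_mat_wide_cases[of a b, where 'a = 'a]) (use assms True in auto)
next
  case False
  show ?thesis
    by (rule ed_mat_tall_cases[of b a, where 'a = 'a]) (use assms False in auto)
qed

text \<open>Since \<open>q - a\<close> is a multiple of \<open>a\<close>, the last block before
  \<open>q\<close> is numbered by its residues. This locates the ones of the identity columns or
  rows at the end of the identity part.\<close>

lemma mod_last_block:
  fixes a q t :: nat
  assumes "a dvd q" "a \<le> q" "t \<le> a"
  shows "(\<lambda>c. c mod a) ` {q - a + t..<q} = {t..<a}"
proof -
  have "a dvd q - a" using assms by auto
  then have "(q - a + i) mod a = i" if "i < a" for i
    using that by (simp add: mod_add_left_eq[symmetric])
  moreover have "{q - a + t..<q} = (\<lambda>i. q - a + i) ` {t..<a}"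
    using assms by (subst image_add_atLeastLessThan) (simp add: add.commute)
  ultimately show ?thesis by (simp only: image_image) force
qed

section \<open>Nonsingular windows\<close>

abbreviation ed_entry :: "nat \<Rightarrow> nat \<Rightarrow> nat \<Rightarrow> nat \<Rightarrow> 'a::field" where
  "ed_entry a b \<equiv> (\<lambda>r c. ed_mat a b $$ (r, c))"

lemma ed_leading_kernel:
  assumes "m \<le> a" "m \<le> b"
  shows "trivial_left_kernel (ed_entry a b :: nat \<Rightarrow> nat \<Rightarrow> 'a::field) {0..<m} {0..<m}"
  by (rule trivial_left_kernel_unit_columns[where p = id and ?C1.0 = "{0..<m}" and ?R2.0 = "{}"
        and ?C2.0 = "{}"])
    (use assms in \<open>auto simp: ed_mat_leading trivial_left_kernel_empty\<close>)

lemma mod_window_image: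
  fixes a s t :: nat
  assumes "0 < a" "s + a \<le> t"
  shows "{0..<a} \<subseteq> (\<lambda>c. c mod a) ` {s..<t}"
proof
  fix r assume r: "r \<in> {0..<a}"
  \<comment> \<open>The candidate with residue \<open>r\<close> in the block containing
    \<open>s\<close>, or in the next block if that candidate lies before \<open>s\<close>.\<close>
  define c where "c = (if s mod a \<le> r then s div a * a + r else s div a * a + a + r)"
  have "c \<in> {s..<t}"
    using r assms mod_less_divisor[OF assms(1), of s] div_mult_mod_eq[of s a]
    unfolding c_def atLeastLessThan_iff
    by (cases "s mod a \<le> r") (simp_all only: if_True if_False, linarith+)
  moreover have "c mod a = r" using r by (simp add: c_def add.assoc)
  ultimately show "r \<in> (\<lambda>c. c mod a) ` {s..<t}" by blast
qed

lemma mod_window_inj: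
  fixes a s t :: nat
  assumes "t \<le> s + a"
  shows "inj_on (\<lambda>c. c mod a) {s..<t}"
proof (rule linorder_inj_onI)
  fix x y assume xy: "x < y" "x \<in> {s..<t}" "y \<in> {s..<t}"
  then have "\<not> a dvd y - x" using assms by (auto dest!: dvd_imp_le)
  then show "x mod a \<noteq> y mod a" using xy(1) by (metis mod_eq_dvd_iff_nat less_imp_le)
qed auto

text \<open>A window inside the identity part contains every unit vector. Otherwise it extends
  \<open>t\<close> columns into the remainder; its identity columns eliminate the rows from
  \<open>t\<close> on, and what is left is the leading \<open>t\<close> by \<open>t\<close> block of
  the remainder, an identity.\<close>

lemma ed_column_window_kernel:
  assumes "a \<le> b" "s + a \<le> b"
  shows "trivial_left_kernel (ed_entry a b :: nat \<Rightarrow> nat \<Rightarrow> 'a::field) {0..<a} {s..<s + a}"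
proof (cases "a = 0")
  case True
  then show ?thesis by (simp add: trivial_left_kernel_empty)
next
  case False
  obtain q r where b: "b = q + r" and r: "r < a" and q: "a \<le> q" "a dvd q"
    and unit: "\<And>i c. i < a \<Longrightarrow> c < q \<Longrightarrow> ed_entry a b i c = (if i = c mod a then 1 else 0 :: 'a)"
    and entry: "\<And>i c. i < a \<Longrightarrow> c < r \<Longrightarrow> ed_entry a b i (c + q) = (ed_entry a r i c :: 'a)"
    by (rule ed_mat_wide_cases[OF _ assms(1)]) (use False in auto)
  show ?thesis
  proof (cases "s + a \<le> q")
    case True
    show ?thesis
      by (rule trivial_left_kernel_unit_columns[where p = "\<lambda>c. c mod a"
            and ?C1.0 = "{s..<s + a}" and ?R2.0 = "{}" and ?C2.0 = "{}"])
        (use True False mod_window_image[of a s "s + a"] in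
          \<open>auto simp: unit trivial_left_kernel_empty\<close>)
  next
    case wrap: False
    define t where "t = s + a - q"
    have t: "t \<le> r" "s + a = q + t" using wrap assms b by (auto simp: t_def)
    have "s = q - a + t" using t q by simp
    then have unit_rows: "(\<lambda>c. c mod a) ` {s..<q} = {t..<a}"
      using mod_last_block[OF q(2,1), of t] t r by simp
    have lead: "trivial_left_kernel (ed_entry a b :: nat \<Rightarrow> nat \<Rightarrow> 'a) {0..<t} {q..<q + t}"
    proof -
      have "trivial_left_kernel (\<lambda>i c. ed_entry a b (i + 0) (c + q) :: 'a) {0..<t} {0..<t}"
        by (rule trivial_left_kernel_cong[OF ed_leading_kernel[of t a r]])
          (use t r entry in auto)
      from trivial_left_kernel_shift[OF this] show ?thesis by (simp add: add.commute)
    qed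
    show ?thesis
      by (rule trivial_left_kernel_unit_columns[where p = "\<lambda>c. c mod a"
            and ?C1.0 = "{s..<q}", OF _ _ _ _ lead])
        (use unit_rows t r in \<open>auto simp: unit\<close>)
  qed
qed

text \<open>The transposed argument: identity rows take the columns from \<open>t\<close> on, and
  the \<open>t\<close> rows reaching into the remainder meet the other columns in a leading identity
  block.\<close>

lemma ed_row_window_kernel:
  assumes "b < a" "s + b \<le> a"
  shows "trivial_left_kernel (ed_entry a b :: nat \<Rightarrow> nat \<Rightarrow> 'a::field) {s..<s + b} {0..<b}"
proof (cases "b = 0")
  case True
  then show ?thesis by (simp add: trivial_left_kernel_empty)
next
  case False
  obtain q r where a: "a = q + r" and r: "r < b" and q: "b \<le> q" "b dvd q"
    and unit: "\<And>i c. i < q \<Longrightarrow> c < b \<Longrightarrow> ed_entry a b i c = (if c = i mod b then 1 else 0 :: 'a)"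
    and entry: "\<And>i c. i < r \<Longrightarrow> c < b \<Longrightarrow> ed_entry a b (i + q) c = (ed_entry r b i c :: 'a)"
    by (rule ed_mat_tall_cases[OF _ assms(1)]) (use False in auto)
  show ?thesis
  proof (cases "s + b \<le> q")
    case True
    show ?thesis
      by (rule trivial_left_kernel_unit_rows[where p = "\<lambda>r. r mod b"
            and ?R1.0 = "{s..<s + b}" and ?R2.0 = "{}" and ?C2.0 = "{}"])
        (use True False mod_window_inj[of "s + b" s b] in
          \<open>auto simp: unit trivial_left_kernel_empty\<close>)
  next
    case wrap: False
    define t where "t = s + b - q"
    have t: "t \<le> r" "s + b = q + t" "0 < t" using wrap assms a by (auto simp: t_def)
    have "s = q - b + t" using t q by simp
    then have unit_cols: "(\<lambda>i. i mod b) ` {s..<q} = {t..<b}"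
      using mod_last_block[OF q(2,1), of t] t r by simp
    have lead: "trivial_left_kernel (ed_entry a b :: nat \<Rightarrow> nat \<Rightarrow> 'a) {q..<q + t} {0..<t}"
    proof -
      have "trivial_left_kernel (\<lambda>i c. ed_entry a b (i + q) (c + 0) :: 'a) {0..<t} {0..<t}"
        by (rule trivial_left_kernel_cong[OF ed_leading_kernel[of t r b]])
          (use t r entry in auto)
      from trivial_left_kernel_shift[OF this] show ?thesis by (simp add: add.commute)
    qed
    have "s \<le> q" using t r by linarith
    then have cut: "{s..<s + b} = {s..<q} \<union> {q..<q + t}" using t by auto
    show ?thesis
      by (rule trivial_left_kernel_unit_rows[where p = "\<lambda>r. r mod b"
            and ?R1.0 = "{s..<q}", OF _ cut _ _ _ _ lead])
        (use unit_cols t r mod_window_inj[of q s b] in \<open>auto simp: unit\<close>)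
  qed
qed

text \<open>Compare \<open>m\<close> with the remainder \<open>r\<close> of one Euclidean step. If
  \<open>m \<le> r\<close>, the block lies in the remainder matrix and is trailing there. Otherwise
  it contains a full side of that matrix, and cancelling the \<open>m - r\<close> adjoining unit
  columns or rows leaves an \<open>r\<close> by \<open>r\<close> window that does not wrap
  around.\<close>

lemma ed_trailing_kernel:
  assumes "m \<le> a" "m \<le> b"
  shows "trivial_left_kernel (ed_entry a b :: nat \<Rightarrow> nat \<Rightarrow> 'a::field) {a - m..<a} {b - m..<b}"
  using assms
proof (induction "a + b" arbitrary: a b m rule: less_induct)
  case less
  show ?case
  proof (cases "m = 0")
    case True
    then show ?thesis by (simp add: trivial_left_kernel_empty)
  next
    case False
    show ?thesis
    proof (cases "a \<le> b")
      case True
      obtain q r where b: "b = q + r" and r: "r < a" and q: "a \<le> q" "a dvd q"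
        and unit: "\<And>i c. i < a \<Longrightarrow> c < q \<Longrightarrow>
          ed_entry a b i c = (if i = c mod a then 1 else 0 :: 'a)"
        and entry: "\<And>i c. i < a \<Longrightarrow> c < r \<Longrightarrow> ed_entry a b i (c + q) = (ed_entry a r i c :: 'a)"
        by (rule ed_mat_wide_cases[OF _ True]) (use False less.prems in auto)
      show ?thesis
      proof (cases "m \<le> r")
        case small: True
        have "trivial_left_kernel (ed_entry a r :: nat \<Rightarrow> nat \<Rightarrow> 'a) {a - m..<a} {r - m..<r}"
          by (rule less.hyps) (use small less.prems r b True q False in auto)
        then have "trivial_left_kernel (\<lambda>i c. ed_entry a b (i + 0) (c + q) :: 'a)
            {a - m..<a} {r - m..<r}"
          by (rule trivial_left_kernel_cong) (use entry in auto)
        from trivial_left_kernel_shift[OF this] show ?thesis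
          using small b by (simp add: add.commute)
      next
        case large: False
        \<comment> \<open>These are the rows that survive once the \<open>m - r\<close> identity
          columns have eliminated the bottom \<open>m - r\<close> rows.\<close>
        have "trivial_left_kernel (ed_entry a r :: nat \<Rightarrow> nat \<Rightarrow> 'a) {a - m..<a - m + r} {0..<r}"
          by (rule ed_row_window_kernel) (use r large less.prems in auto)
        then have "trivial_left_kernel (\<lambda>i c. ed_entry a b (i + 0) (c + q) :: 'a)
            {a - m..<a - m + r} {0..<r}"
          by (rule trivial_left_kernel_cong) (use entry large less.prems in auto)
        from trivial_left_kernel_shift[OF this]
        have rest: "trivial_left_kernel (ed_entry a b :: nat \<Rightarrow> nat \<Rightarrow> 'a)
            {a - m..<a - m + r} {q..<b}"
          using b by (simp add: add.commute)
        \<comment> \<open>The window begins at offset \<open>a - m + r\<close> of the last identity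
          block, so its identity columns have their ones exactly in the rows from there to the
          bottom.\<close>
        have "b - m = q - a + (a - m + r)" using b q less.prems large by simp
        then have unit_rows: "(\<lambda>c. c mod a) ` {b - m..<q} = {a - m + r..<a}"
          using mod_last_block[OF q(2,1), of "a - m + r"] less.prems large by simp
        have "q \<le> b" using b by simp
        show ?thesis
          by (rule trivial_left_kernel_unit_columns[where p = "\<lambda>c. c mod a"
                and ?C1.0 = "{b - m..<q}", OF _ _ _ _ rest])
            (use unit_rows \<open>q \<le> b\<close> large less.prems in \<open>auto simp: unit\<close>)
      qed
    next
      case tall: False
      obtain q r where a: "a = q + r" and r: "r < b" and q: "b \<le> q" "b dvd q"
        and unit: "\<And>i c. i < q \<Longrightarrow> c < b \<Longrightarrow>
          ed_entry a b i c = (if c = i mod b then 1 else 0 :: 'a)"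
        and entry: "\<And>i c. i < r \<Longrightarrow> c < b \<Longrightarrow> ed_entry a b (i + q) c = (ed_entry r b i c :: 'a)"
        by (rule ed_mat_tall_cases[of b a]) (use False tall less.prems in auto)
      show ?thesis
      proof (cases "m \<le> r")
        case small: True
        have "trivial_left_kernel (ed_entry r b :: nat \<Rightarrow> nat \<Rightarrow> 'a) {r - m..<r} {b - m..<b}"
          by (rule less.hyps) (use small less.prems r a tall q False in auto)
        then have "trivial_left_kernel (\<lambda>i c. ed_entry a b (i + q) (c + 0) :: 'a)
            {r - m..<r} {b - m..<b}"
          by (rule trivial_left_kernel_cong) (use entry in auto)
        from trivial_left_kernel_shift[OF this] show ?thesis
          using small a by (simp add: add.commute)
      next
        case large: False
        \<comment> \<open>Dually, the identity rows use up the last \<open>m - r\<close> columns,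
          and a column window of the remainder matrix is left.\<close>
        have "trivial_left_kernel (ed_entry r b :: nat \<Rightarrow> nat \<Rightarrow> 'a) {0..<r} {b - m..<b - m + r}"
          by (rule ed_column_window_kernel) (use r large less.prems in auto)
        then have "trivial_left_kernel (\<lambda>i c. ed_entry a b (i + q) (c + 0) :: 'a)
            {0..<r} {b - m..<b - m + r}"
          by (rule trivial_left_kernel_cong) (use entry large less.prems in auto)
        from trivial_left_kernel_shift[OF this]
        have rest: "trivial_left_kernel (ed_entry a b :: nat \<Rightarrow> nat \<Rightarrow> 'a)
            {q..<a} {b - m..<b - m + r}"
          using a by (simp add: add.commute)
        have "a - m = q - b + (b - m + r)" using a q less.prems large by simp
        then have unit_cols: "(\<lambda>i. i mod b) ` {a - m..<q} = {b - m + r..<b}"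
          using mod_last_block[OF q(2,1), of "b - m + r"] less.prems large by simp
        have cut: "{a - m..<a} = {a - m..<q} \<union> {q..<a}" using a large by auto
        have unit': "ed_entry a b i c = (if c = i mod b then 1 else 0 :: 'a)"
          if "i \<in> {a - m..<q}" "c \<in> {b - m..<b}" for i c
          using that unit by simp
        have inj: "inj_on (\<lambda>i. i mod b) {a - m..<q}"
          by (rule mod_window_inj) (use a less.prems in simp)
        show ?thesis
          by (rule trivial_left_kernel_unit_rows[where C = "{b - m..<b}",
                OF _ cut _ unit' inj _ rest])
            (use unit_cols large less.prems in auto)
      qed
    qed
  qed
qed

text \<open>A wrapping window consists of the last \<open>w\<close> and the first
  \<open>a - w\<close> columns. The latter are the unit vectors of the top \<open>a - w\<close>
  rows, so the trailing \<open>w\<close> by \<open>w\<close> block remains.\<close>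

lemma ed_cyclic_window_kernel:
  assumes "a \<le> b" "s < b"
  shows "trivial_left_kernel (ed_entry a b :: nat \<Rightarrow> nat \<Rightarrow> 'a::field)
    {0..<a} ((\<lambda>j. (s + j) mod b) ` {0..<a})"
proof (cases "s + a \<le> b")
  case True
  have "(\<lambda>j. (s + j) mod b) ` {0..<a} = (\<lambda>j. s + j) ` {0..<a}"
    using True by (intro image_cong) auto
  also have "\<dots> = {s..<s + a}" by (simp add: add.commute)
  finally show ?thesis using ed_column_window_kernel[OF assms(1) True] by simp
next
  case False
  define w where "w = b - s"
  have w: "w < a" "b = s + w" using False assms by (auto simp: w_def)
  have "{b - w..<b} \<union> {0..<a - w} \<subseteq> (\<lambda>j. (s + j) mod b) ` {0..<a}"
  proof
    fix c assume c: "c \<in> {b - w..<b} \<union> {0..<a - w}"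
    \<comment> \<open>Columns at the left edge are reached after the \<open>w\<close> steps that
      exhaust the right edge; the others lie before the wrap.\<close>
    define j where "j = (if c < a - w then w + c else c - s)"
    have "j \<in> {0..<a}" "(s + j) mod b = c"
      using c w assms by (auto simp: j_def add.assoc[symmetric])
    then show "c \<in> (\<lambda>j. (s + j) mod b) ` {0..<a}" by blast
  qed
  then show ?thesis
    by (intro trivial_left_kernel_unit_columns[where p = id and ?C1.0 = "{0..<a - w}",
          OF _ _ _ _ ed_trailing_kernel[of w]])
      (use w assms in \<open>auto simp: ed_mat_leading\<close>)
qed

section \<open>From trivial kernels to spanning columns\<close>

lemma trivial_left_kernel_image:
  "trivial_left_kernel f R (h ` C) \<longleftrightarrow> trivial_left_kernel (\<lambda>r c. f r (h c)) R C"
  by (simp add: trivial_left_kernel_def)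

text \<open>For the square matrix \<open>A\<close> with columns \<open>g j\<close>, the kernel
  condition says that the transpose is injective. Hence \<open>A\<close> has an inverse
  \<open>B\<close>, and \<open>A *\<^sub>v (B *\<^sub>v y)\<close> writes any \<open>y\<close> as a
  combination of the columns.\<close>

lemma vec_span_eq_carrier_if_trivial_left_kernel:
  fixes g :: "nat \<Rightarrow> 'a::field vec"
  assumes g: "\<And>j. j < M \<Longrightarrow> g j \<in> carrier_vec M"
    and ker: "trivial_left_kernel (\<lambda>r j. g j $ r) {0..<M} {0..<M}"
  shows "vec_span M (g ` {0..<M}) = carrier_vec M"
proof -
  interpret vec_space "TYPE('a)" M .
  define A where "A = mat M M (\<lambda>(r, j). g j $ r)"
  have A: "A \<in> carrier_mat M M" by (simp add: A_def)
  have "v = 0\<^sub>v M" if v: "v \<in> carrier_vec M" "A\<^sup>T *\<^sub>v v = 0\<^sub>v M" for v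
  proof -
    have "(\<Sum>r\<in>{0..<M}. v $ r * g j $ r) = 0" if j: "j \<in> {0..<M}" for j
    proof -
      have "(A\<^sup>T *\<^sub>v v) $ j = (\<Sum>r\<in>{0..<M}. v $ r * g j $ r)"
        using j v(1) by (auto simp: A_def scalar_prod_def intro!: sum.cong)
      then show ?thesis using v(2) j by simp
    qed
    then have "v $ r = 0" if "r \<in> {0..<M}" for r
      using trivial_left_kernelD[OF ker, of "\<lambda>r. v $ r"] that by blast
    then show ?thesis using v(1) by (intro eq_vecI) auto
  qed
  then have "det A\<^sup>T \<noteq> 0"
    using det_0_iff_vec_prod_zero_field[of "A\<^sup>T" M] A by auto
  then have "det A \<noteq> 0" using det_transpose[OF A] by simp
  then have "A \<in> Units (ring_mat TYPE('a) M ())" by (rule det_non_zero_imp_unit[OF A])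
  then obtain B where B: "B \<in> carrier_mat M M" "A * B = 1\<^sub>m M"
    by (auto simp: Units_def ring_mat_def)
  have "y \<in> col_space A" if y: "y \<in> carrier_vec M" for y
  proof -
    have "A *\<^sub>v (B *\<^sub>v y) = y" using B y A by (simp add: assoc_mult_mat_vec[symmetric])
    moreover have "B *\<^sub>v y \<in> carrier_vec M" using B y by simp
    ultimately show ?thesis unfolding col_space_eq[OF A] using A y by auto
  qed
  moreover have "set (cols A) = g ` {0..<M}"
  proof -
    have "col A j = g j" if "j < M" for j
      using g[OF that] that by (intro eq_vecI) (auto simp: A_def)
    then show ?thesis using A by (auto simp: cols_def image_iff)
  qed
  ultimately have "carrier_vec M \<subseteq> vec_span M (g ` {0..<M})"
    unfolding col_space_def vec_span_def by auto
  moreover have "g ` {0..<M} \<subseteq> carrier_vec M" using g by auto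
  ultimately show ?thesis using vec_span_closed by blast
qed

lemma ed_cyclic_window_span:
  fixes G :: "'a::field mat"
  assumes "M \<le> N" "s < N" "G = ed_mat M N"
  shows "vec_span M ((\<lambda>j. col G ((s + j) mod N)) ` {0..<M}) = carrier_vec M"
proof (rule vec_span_eq_carrier_if_trivial_left_kernel)
  show "col G ((s + j) mod N) \<in> carrier_vec M" for j
    using assms(3) by (simp add: carrier_vecI)
  have "trivial_left_kernel (\<lambda>r j. ed_entry M N r ((s + j) mod N) :: 'a) {0..<M} {0..<M}"
    using ed_cyclic_window_kernel[OF assms(1,2)] by (simp add: trivial_left_kernel_image)
  then show "trivial_left_kernel (\<lambda>r j. col G ((s + j) mod N) $ r) {0..<M} {0..<M}"
    by (rule trivial_left_kernel_cong) (use assms in simp)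
qed

theorem mainTheorem4:
  fixes n \<alpha> M :: nat and G :: "'a::{finite,field} mat"
  assumes "n \<ge> 2" and "\<alpha> \<ge> 1" and "M \<ge> 1" and "M \<le> n * \<alpha>"
    and "G = ed_mat M (n * \<alpha>)"
  shows "ordss n \<alpha> M (node_block \<alpha> G)"
proof -
  have G: "G \<in> carrier_mat M (n * \<alpha>)" using assms(5) ed_mat_carrier by simp
  have cols: "col G j \<in> carrier_vec M" for j using G by (simp add: carrier_vecI)
  \<comment> \<open>The window starting at column 0 already spans, which gives full row
    rank.\<close>
  have "(\<lambda>j. col G ((0 + j) mod (n * \<alpha>))) ` {0..<M} \<subseteq> set (cols G)"
    using assms G by (auto simp: cols_def)
  from vec_span_mono[OF this, of M]
  have "carrier_vec M \<subseteq> vec_span M (set (cols G))"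
    using ed_cyclic_window_span[of M "n * \<alpha>" 0 G] assms by auto
  moreover have "vec_span M (set (cols G)) \<subseteq> carrier_vec M"
    using cols G by (intro vec_span_closed) (auto simp: cols_def)
  ultimately have "vec_space.rank M G = M" by (intro rank_eq_if_cols_span) blast
  then have "storage_scheme n \<alpha> M (node_block \<alpha> G)"
    using G by (auto simp: storage_scheme_def generator_mat_node_block node_block_def)
  moreover have "\<exists>ts. is_protocol n M (node_block \<alpha> G) i ts \<and> reconstructs M i ts \<and>
      (let k = real_of_int \<lceil>real M / real \<alpha>\<rceil>
       in real (bandwidth ts) = k * real M - (k - 1) * k * real \<alpha> / 2)"
    if i: "i \<in> {1..n}" for i
  proof -
    obtain k where k: "real_of_int \<lceil>real M / real \<alpha>\<rceil> = real k" "0 < k" "M \<le> k * \<alpha>"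
      and load: "\<And>t. t < k \<Longrightarrow> t * \<alpha> \<le> M"
      using ceiling_divide_nat[of M \<alpha>] assms(2,3) by auto
    \<comment> \<open>The \<open>M\<close> cyclically consecutive columns that begin with the first
      node vector of node \<open>i\<close>; block \<open>t\<close> of them is stored at distance
      \<open>t\<close> upstream.\<close>
    define g where "g = (\<lambda>j. col G (((i - 1) * \<alpha> + j) mod (n * \<alpha>)))"
    define ts where "ts = relay_rounds n \<alpha> M g i k k"
    have "is_protocol n M (node_block \<alpha> G) i ts"
      unfolding ts_def
      by (rule relay_rounds_protocol[OF i k(3) order_refl])
        (use cols assms(1) G node_block_column_stored[of G n \<alpha>] in \<open>auto simp: g_def\<close>)
    moreover have "reconstructs M i ts"
    proof -
      have "i - 1 < n" using i by auto
      then have "(i - 1) * \<alpha> < n * \<alpha>" using assms(2) by simp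
      then have "vec_span M (g ` {0..<M}) = carrier_vec M"
        unfolding g_def using assms by (intro ed_cyclic_window_span) auto
      moreover have "received ts (User i) = g ` {0..<M}"
        unfolding ts_def
        by (intro equalityI received_relay_rounds[OF k(2)] received_relay_rounds_subset)
      ultimately show ?thesis by (simp add: reconstructs_def)
    qed
    moreover have "real (bandwidth ts) = real k * real M - (real k - 1) * real k * real \<alpha> / 2"
      using sum_relay_loads[OF load] by (simp add: bandwidth_def ts_def length_relay_rounds)
    ultimately show ?thesis using k(1) by auto
  qed
  ultimately show ?thesis by (simp add: ordss_def)
qed

end
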